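(* Let $n\ge m\ge 1$, let $\mathbf{v}_1,\dots,\mathbf{v}_m\in\mathbb{R}^n$ be linearly independent, let $\mathbf{x}_0\in\mathbb{R}^n$, and let $$ P_m := \Bigl\{ \mathbf{x}_0 + \sum_{i=1}^m s_i \mathbf{v}_i : \ 0 \le s_i \le 1, \ i=1,\ldots, m \Bigr\}. $$ Let $A=[\mathbf{v}_1,\dots,\mathbf{v}_m]$ be the $n\times m$ matrix whose columns are the generating vectors. Then the $m$-dimensional volume of $P_m$ is $$ \operatorname{Vol}_m(P_m) = \sqrt{\det(A^\top A)}. $$ Consequently, if $\Sigma\subset\mathbb{R}^n$ is the image of a reference domain $\Sigma_s\subset\mathbb{R}^m$ under the affine map $\mathbf{s}\mapsto\mathbf{x}_0+A\mathbf{s}$, then $$\frac{|\Sigma|}{|\Sigma_s|}=\sqrt{\det(A^\top A)}.$$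
   Context: $\operatorname{Vol}_m$ denotes $m$-dimensional volume ($m$-dimensional Lebesgue measure on the $m$-dimensional affine subspace of $\mathbb{R}^n$ containing the set). $|\Sigma|$ and $|\Sigma_s|$ denote the $m$-dimensional measures of $\Sigma$ and $\Sigma_s$; $\Sigma_s$ is a (bounded, measurable) domain, e.g. a polytope, of positive measure. *)

theory Defs
  imports "HOL-Analysis.Analysis"
begin

(* The dimensions are index types: m = CARD('m), n = CARD('n). *)

(* An isometry f of real^'m onto H exists exactly when H is an affine subspace of dimension
   CARD('m).  Lebesgue measure on H is the Lebesgue measure of real^'m transported along f;
   the choice of f is immaterial, because Lebesgue measure is invariant under isometries. *)
definition affine_lebesgue :: "'m::finite itself \<Rightarrow> (real^'n) set \<Rightarrow> (real^'n) measure" where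
  "affine_lebesgue TYPE('m) H =
     embed_measure lebesgue
       (SOME f :: real^'m \<Rightarrow> real^'n. (\<forall>x y. dist (f x) (f y) = dist x y) \<and> range f = H)"

(* If S lies in two different affine subspaces of dimension CARD('m), it lies in their intersection,
   which is a null set for both, so the choice of H is immaterial too.  The value is meaningful only
   if such an H exists and S is measurable in it; measure assigns 0 to non-measurable sets. *)
definition Vol :: "'m::finite itself \<Rightarrow> (real^'n) set \<Rightarrow> real" where
  "Vol TYPE('m) S =
     measure (affine_lebesgue TYPE('m)
       (SOME H. affine H \<and> aff_dim H = int CARD('m) \<and> S \<subseteq> H)) S"

end

theory Submission
  imports Defs
begin

text \<open>
  Write \<open>g s = x0 + A *v s\<close>, and let \<open>S\<close> be a measurable set of finite positive measure.

  The set \<open>S\<close> is not negligible, so no hyperplane contains it and its affine hull is the whole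
  space. Hence \<open>range g\<close> is the affine hull of \<open>g ` S\<close>, and it lies in every affine subspace \<open>H\<close>
  that contains \<open>g ` S\<close>.

  Let \<open>f\<close> be any isometry of \<open>real^'m\<close> onto \<open>H\<close>. The volume of \<open>g ` S\<close> in \<open>H\<close> is the Lebesgue
  measure of \<open>h ` S\<close>, where \<open>h\<close> is \<open>g\<close> followed by the inverse of \<open>f\<close>. Isometries preserve
  inner products of differences, so \<open>k s = h s - h 0\<close> satisfies
  \<open>k s \<bullet> k t = (A *v s) \<bullet> (A *v t)\<close>. This identity alone makes \<open>k\<close> linear
  (\<open>linear_if_inner_eq\<close>), and it says that the square matrix \<open>B\<close> of \<open>k\<close> has the Gram matrix of \<open>A\<close>,
  \<open>transpose B ** B = transpose A ** A\<close>. So \<open>\<bar>det B\<bar> = sqrt (det (transpose A ** A))\<close>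
  (\<open>det_gram_eq_square\<close>), and \<open>\<bar>det B\<bar>\<close> is the factor by which \<open>h\<close> scales Lebesgue measure
  (\<open>measure_matrix_image\<close>). The argument works for every admissible \<open>f\<close> and \<open>H\<close>, so it covers the ones
  that the Hilbert choices in \<open>affine_lebesgue\<close> and \<open>Vol\<close> pick. The parallelepiped is the case in
  which \<open>S\<close> is the unit cube.

  The theorem \<open>measure_linear_image\<close>, on the factor \<open>\<bar>det B\<bar>\<close>, speaks of well-ordered index types,
  whereas \<open>'m\<close> is only finite. It is carried over to \<open>'m\<close> from a well-ordered copy of \<open>'m\<close>, since a
  renaming of the coordinates changes neither Lebesgue measure nor determinants.
\<close>

section \<open>Reindexing coordinates\<close>

definition reindex :: "('k::finite \<Rightarrow> 'm::finite) \<Rightarrow> real^'m \<Rightarrow> real^'k" where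
  "reindex r x = (\<chi> i. x $ r i)"

lemma prod_Basis_cart:
  fixes f :: "real^'n \<Rightarrow> 'b::comm_monoid_mult"
  shows "(\<Prod>b\<in>Basis. f b) = (\<Prod>i\<in>UNIV. f (axis i 1))"
proof -
  have "(Basis :: (real^'n) set) = range (\<lambda>i. axis i 1)"
    by (auto simp: Basis_vec_def)
  moreover have "inj (\<lambda>i::'n. axis i (1::real))"
    by (auto simp: inj_on_def axis_eq_axis)
  ultimately show ?thesis
    using prod.reindex[of "\<lambda>i::'n. axis i (1::real)" UNIV f] by (simp only: o_def)
qed

lemma linear_reindex: "linear (reindex r)"
  by (rule linearI) (auto simp: reindex_def vec_eq_iff)

lemma borel_measurable_reindex [measurable]: "reindex r \<in> borel_measurable borel"
  by (intro borel_measurable_continuous_onI linear_continuous_on linear_reindex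
      linear_conv_bounded_linear[THEN iffD1])

lemma reindex_inverse:
  assumes "bij r"
  shows "reindex r (reindex (inv r) x) = x" "reindex (inv r) (reindex r y) = y"
  using assms by (auto simp: reindex_def vec_eq_iff bij_is_inj bij_is_surj surj_f_inv_f)

lemma reindex_vimage:
  assumes "bij r"
  shows "reindex r -` S = reindex (inv r) ` S"
  using reindex_inverse[OF assms] by (auto simp: image_iff intro: sym)

text \<open>
  Lebesgue measure is determined by its values on boxes, and reindexing permutes the side lengths of
  a box.
\<close>

lemma lborel_distr_reindex:
  fixes r :: "'k::finite \<Rightarrow> 'm::finite"
  assumes r: "bij r"
  shows "lborel = distr lborel borel (reindex r)"
proof (rule lborel_eqI)
  fix l u :: "real^'k" assume le: "\<And>b. b \<in> Basis \<Longrightarrow> l \<bullet> b \<le> u \<bullet> b"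
  let ?l = "reindex (inv r) l" and ?u = "reindex (inv r) u"
  have inv: "inv r (r i) = i" "r (inv r j) = j" for i j
    using r by (auto simp: bij_is_inj bij_is_surj surj_f_inv_f)
  have lu: "l $ i \<le> u $ i" for i
    using le[of "axis i 1"] by (simp add: inner_axis)
  have "reindex r -` box l u = box ?l ?u"
    by (auto simp: mem_box_cart reindex_def) (metis inv)+
  then have "emeasure (distr lborel borel (reindex r)) (box l u) = emeasure lborel (box ?l ?u)"
    by (simp add: emeasure_distr)
  also have "\<dots> = ennreal (\<Prod>b\<in>Basis. (?u - ?l) \<bullet> b)"
    by (rule emeasure_lborel_box) (use lu in \<open>auto simp: Basis_vec_def inner_axis reindex_def\<close>)
  also have "(\<Prod>b\<in>Basis. (?u - ?l) \<bullet> b) = (\<Prod>j\<in>UNIV. (u - l) $ inv r j)"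
    by (simp add: prod_Basis_cart inner_axis reindex_def)
  also have "\<dots> = (\<Prod>i\<in>UNIV. (u - l) $ i)"
    by (rule prod.reindex_bij_betw) (use r bij_imp_bij_inv in blast)
  also have "\<dots> = (\<Prod>b\<in>Basis. (u - l) \<bullet> b)"
    by (simp add: prod_Basis_cart inner_axis)
  finally show "emeasure (distr lborel borel (reindex r)) (box l u) = (\<Prod>b\<in>Basis. (u - l) \<bullet> b)" .
qed simp

text \<open>
  The same for the completion: since the image measure is Lebesgue measure, both have the same null
  sets, so completing commutes with taking the image measure.
\<close>

lemma lebesgue_distr_reindex:
  fixes r :: "'k::finite \<Rightarrow> 'm::finite"
  assumes r: "bij r"
  shows "reindex r \<in> lebesgue \<rightarrow>\<^sub>M lebesgue" (is ?meas)
    and "lebesgue = distr lebesgue lebesgue (reindex r)"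
proof -
  have eq: "distr lebesgue lborel (reindex r) = lborel"
    using lborel_distr_reindex[OF r] by (simp add: distr_completion cong: distr_cong)
  show ?meas
    by (simp add: completion.measurable_completion2 eq measurable_completion)
  have "lebesgue = completion (distr lebesgue lborel (reindex r))"
    by (simp only: eq)
  also have "\<dots> = distr lebesgue lebesgue (reindex r)"
    by (rule completion.completion_distr_eq) (auto simp: eq measurable_completion)
  finally show "lebesgue = distr lebesgue lebesgue (reindex r)" .
qed

lemma reindex_image:
  assumes r: "bij r" and S: "S \<in> lmeasurable"
  shows "reindex r ` S \<in> lmeasurable" "measure lebesgue (reindex r ` S) = measure lebesgue S"
proof -
  let ?q = "inv r"
  have q: "bij ?q" and "inv ?q = r"
    using r by (auto simp: bij_imp_bij_inv inv_inv_eq)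
  then have vim: "reindex ?q -` S = reindex r ` S"
    using reindex_vimage[OF q] by simp
  have meas: "S \<in> sets lebesgue" using S by auto
  have img: "reindex r ` S \<in> sets lebesgue"
    using measurable_sets[OF lebesgue_distr_reindex(1)[OF q] meas] by (simp add: vim)
  have em: "emeasure lebesgue (reindex r ` S) = emeasure lebesgue S"
    using arg_cong[OF lebesgue_distr_reindex(2)[OF q], of "\<lambda>M. emeasure M S"]
    by (simp add: emeasure_distr lebesgue_distr_reindex(1)[OF q] meas vim)
  show "reindex r ` S \<in> lmeasurable"
    using img em S unfolding fmeasurable_def by (simp del: emeasure_completion)
  show "measure lebesgue (reindex r ` S) = measure lebesgue S"
    using em by (simp add: measure_def)
qed

text \<open>
  Conjugation with \<open>r\<close> is a sign-preserving bijection between the permutations of the two index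
  types, and it matches the terms of the two Leibniz sums.
\<close>

lemma det_reindex:
  fixes B :: "real^'m^'m" and r :: "'k::finite \<Rightarrow> 'm::finite"
  assumes r: "bij r"
  shows "det (\<chi> i j. B $ r i $ r j) = det B"
proof -
  let ?\<phi> = "map_permutation UNIV r"
  have inj: "inj r" using r by (rule bij_is_inj)
  have surj: "inv r (r i) = i" "r (inv r j) = j" for i j
    using r by (auto simp: bij_is_inj bij_is_surj surj_f_inv_f)
  have "(\<Sum>p | p permutes (UNIV::'k set). of_int (sign p) * (\<Prod>i\<in>UNIV. B $ r i $ r (p i)))
      = (\<Sum>p | p permutes (UNIV::'m set). of_int (sign p) * (\<Prod>i\<in>UNIV. B $ i $ p i))"
  proof (rule sum.reindex_bij_witness[where j = ?\<phi> and i = "map_permutation UNIV (inv r)"])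
    fix p :: "'k \<Rightarrow> 'k" assume "p \<in> {p. p permutes UNIV}"
    then have p: "p permutes UNIV" by simp
    show "map_permutation UNIV (inv r) (?\<phi> p) = p"
      by (rule map_permutation_compose_inv[OF r p]) (simp add: surj)
    show "?\<phi> p \<in> {p. p permutes UNIV}"
      using map_permutation_permutes[OF r p] by simp
    have "(\<Prod>i\<in>UNIV. B $ i $ ?\<phi> p i) = (\<Prod>i\<in>UNIV. B $ r i $ ?\<phi> p (r i))"
      by (rule prod.reindex_bij_betw[OF r, symmetric])
    then show "of_int (sign (?\<phi> p)) * (\<Prod>i\<in>UNIV. B $ i $ ?\<phi> p i) =
        of_int (sign p) * (\<Prod>i\<in>UNIV. B $ r i $ r (p i))"
      by (simp add: sign_map_permutation[OF inj p] map_permutation_apply[OF inj])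
  next
    fix p :: "'m \<Rightarrow> 'm" assume "p \<in> {p. p permutes UNIV}"
    then have p: "p permutes UNIV" by simp
    have q: "bij (inv r)" using r by (rule bij_imp_bij_inv)
    show "?\<phi> (map_permutation UNIV (inv r) p) = p"
      by (rule map_permutation_compose_inv[OF q p]) (simp add: surj)
    show "map_permutation UNIV (inv r) p \<in> {p. p permutes UNIV}"
      using map_permutation_permutes[OF q p] by simp
  qed
  then show ?thesis by (simp add: det_def)
qed

section \<open>Measure of linear images\<close>

text \<open>
  A copy of a type, ordered by an enumeration when the type is finite. A copy is needed because the
  type itself may already carry another order.
\<close>

typedef 'a ranked = "UNIV :: 'a set" by simp

lemma bij_Rep_ranked: "bij Rep_ranked"
  by (rule bijI') (auto simp: Rep_ranked_inject intro: Abs_ranked_inverse[OF UNIV_I, symmetric])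

instance ranked :: (finite) finite
proof
  show "finite (UNIV :: 'a ranked set)"
    using bij_betw_finite[of "Rep_ranked :: _ \<Rightarrow> 'a" UNIV UNIV] bij_Rep_ranked by simp
qed

instantiation ranked :: (finite) wellorder
begin

definition "x \<le> y \<longleftrightarrow> to_nat (Rep_ranked x) \<le> to_nat (Rep_ranked y)"
definition "x < y \<longleftrightarrow> to_nat (Rep_ranked x) < to_nat (Rep_ranked y)"

instance
proof
  fix P :: "'a ranked \<Rightarrow> bool" and a
  assume step: "\<And>x. (\<And>y. y < x \<Longrightarrow> P y) \<Longrightarrow> P x"
  show "P a"
    by (induction a rule: measure_induct_rule[where f = "\<lambda>x. to_nat (Rep_ranked x)"])
      (rule step, simp add: less_ranked_def)
qed (auto simp: less_eq_ranked_def less_ranked_def Rep_ranked_inject)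

end

text \<open>
  Renaming the coordinates conjugates \<open>B\<close> to a matrix indexed by the well-ordered copy, for which
  \<open>measure_linear_image\<close> gives the factor.
\<close>

lemma measure_matrix_image:
  fixes B :: "real^'m::finite^'m"
  assumes S: "S \<in> lmeasurable"
  shows "(*v) B ` S \<in> lmeasurable"
    and "measure lebesgue ((*v) B ` S) = \<bar>det B\<bar> * measure lebesgue S"
proof -
  let ?r = "Rep_ranked :: 'm ranked \<Rightarrow> 'm"
  let ?T = "reindex ?r" and ?T' = "reindex (inv ?r)"
  let ?C = "(\<chi> i j. B $ ?r i $ ?r j)"
  have r: "bij ?r" by (rule bij_Rep_ranked)
  have q: "bij (inv ?r)" using r by (rule bij_imp_bij_inv)
  have "?C *v ?T x = ?T (B *v x)" for x
    using sum.reindex_bij_betw[OF r, of "\<lambda>j. B $ _ $ j * x $ j"]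
    by (simp add: reindex_def matrix_vector_mult_def vec_eq_iff)
  then have "B *v x = ?T' (?C *v ?T x)" for x
    by (simp add: reindex_inverse[OF r])
  then have img: "(*v) B ` S = ?T' ` ((*v) ?C ` (?T ` S))"
    by (simp add: image_image)
  note TS = reindex_image[OF r S]
  note CTS = measurable_linear_image[OF matrix_vector_mul_linear[of ?C] TS(1)]
    measure_linear_image[OF matrix_vector_mul_linear[of ?C] TS(1)]
  show "(*v) B ` S \<in> lmeasurable"
    unfolding img by (rule reindex_image(1)[OF q CTS(1)])
  show "measure lebesgue ((*v) B ` S) = \<bar>det B\<bar> * measure lebesgue S"
    unfolding img reindex_image(2)[OF q CTS(1)] CTS(2) TS(2)
    by (simp add: det_reindex[OF r])
qed

section \<open>Isometries and Gram determinants\<close>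

text \<open>
  The squared norm of a linear combination of values of \<open>k\<close> expands into inner products, so it equals
  the squared norm of the same combination of values of \<open>g\<close>. The defects of additivity and
  homogeneity of \<open>k\<close> therefore have norm zero.
\<close>

lemma linear_if_inner_eq:
  fixes k :: "'a::real_vector \<Rightarrow> 'b::real_inner" and g :: "'a \<Rightarrow> 'c::real_inner"
  assumes g: "linear g" and eq: "\<And>x y. k x \<bullet> k y = g x \<bullet> g y"
  shows "linear k"
proof (rule linearI)
  fix x y c
  have "(k (x + y) - (k x + k y)) \<bullet> (k (x + y) - (k x + k y)) =
      (g (x + y) - (g x + g y)) \<bullet> (g (x + y) - (g x + g y))"
    by (simp only: inner_diff_left inner_diff_right inner_add_left inner_add_right eq)
  then show "k (x + y) = k x + k y"
    by (simp add: linear_add[OF g])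
  have "(k (c *\<^sub>R x) - c *\<^sub>R k x) \<bullet> (k (c *\<^sub>R x) - c *\<^sub>R k x) =
      (g (c *\<^sub>R x) - c *\<^sub>R g x) \<bullet> (g (c *\<^sub>R x) - c *\<^sub>R g x)"
    by (simp only: inner_diff_left inner_diff_right inner_scaleR_left inner_scaleR_right eq)
  then show "k (c *\<^sub>R x) = c *\<^sub>R k x"
    by (simp add: linear_scale[OF g])
qed

lemma isometry_inner_diff:
  fixes f :: "'a::real_inner \<Rightarrow> 'b::real_inner"
  assumes "\<And>x y. dist (f x) (f y) = dist x y"
  shows "(f x - f z) \<bullet> (f y - f z) = (x - z) \<bullet> (y - z)"
  using assms[of x z] assms[of y z] assms[of x y]
  by (simp add: dot_norm_neg dist_norm)

text \<open>
  The hypothesis, taken at the unit vectors, says that \<open>A\<close> and \<open>B\<close> have the same Gram matrix; the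
  determinant of \<open>transpose B ** B\<close> is a square because \<open>B\<close> is square.
\<close>

lemma det_gram_eq_square:
  fixes A :: "real^'m::finite^'n" and B :: "real^'m^'m"
  assumes "\<And>x y. (B *v x) \<bullet> (B *v y) = (A *v x) \<bullet> (A *v y)"
  shows "\<bar>det B\<bar> = sqrt (det (transpose A ** A))"
proof -
  have gram: "(transpose M ** M) $ i $ j = (M *v axis i 1) \<bullet> (M *v axis j 1)"
    for M :: "real^'m^'k" and i j
    by (simp add: matrix_vector_mult_basis matrix_matrix_mult_def transpose_def
        column_def inner_vec_def)
  have "transpose B ** B = transpose A ** A"
    by (simp add: vec_eq_iff gram assms)
  then have "det (transpose A ** A) = (det B)\<^sup>2"
    by (metis det_mul det_transpose power2_eq_square)
  then show ?thesis by simp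
qed

text \<open>
  Shows that the choice of an isometry in \<open>affine_lebesgue\<close> is a choice from a nonempty set.
\<close>

lemma isometry_onto_affine:
  fixes H :: "(real^'n) set"
  assumes H: "affine H" and dim: "aff_dim H = int CARD('m::finite)"
  obtains f :: "real^'m \<Rightarrow> real^'n" where "\<And>x y. dist (f x) (f y) = dist x y" "range f = H"
proof -
  obtain a where a: "a \<in> H" using dim by (cases "H = {}") auto
  let ?L = "(+) (- a) ` H"
  have L: "subspace ?L" using affine_diffs_subspace[OF H a] by simp
  have "dim ?L = CARD('m)"
    using aff_dim_subspace[OF L] dim aff_dim_translation_eq[of "- a" H] by simp
  then have "dim (UNIV :: (real^'m) set) = dim ?L" by simp
  then obtain l :: "real^'m \<Rightarrow> real^'n"
    where l: "linear l" "range l = ?L" "\<And>x. norm (l x) = norm x"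
    using isometry_subspaces[OF subspace_UNIV L] by (metis UNIV_I)
  show ?thesis
  proof
    show "dist (a + l x) (a + l y) = dist x y" for x y
      using l(3)[of "x - y"] by (simp add: dist_norm linear_diff[OF l(1)])
    have "range (\<lambda>x. a + l x) = (+) a ` range l" by auto
    also have "\<dots> = H" unfolding l(2) by (simp add: image_image)
    finally show "range (\<lambda>x. a + l x) = H" .
  qed
qed

section \<open>Volume of affine images\<close>

lemma affine_hull_UNIV_if_not_negligible:
  fixes S :: "'a::euclidean_space set"
  assumes "\<not> negligible S"
  shows "affine hull S = UNIV"
proof (rule ccontr)
  assume "affine hull S \<noteq> UNIV"
  then have "aff_dim S < DIM('a)"
    using aff_dim_eq_full[of S] aff_dim_le_DIM[of S] by linarith
  then obtain a b where "a \<noteq> 0" "S \<subseteq> {x. a \<bullet> x = b}"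
    by (rule aff_lowdim_subset_hyperplane)
  then show False
    using assms negligible_hyperplane negligible_subset by blast
qed

text \<open>
  Seen through an isometry onto \<open>H\<close>, the affine map becomes \<open>h\<close>, an affine map of \<open>real^'m\<close> into
  itself. Its linear part \<open>k\<close> has the Gram matrix of \<open>A\<close>.
\<close>

lemma measure_affine_lebesgue:
  fixes A :: "real^'m::finite^'n" and x0 :: "real^'n"
  assumes S: "S \<in> lmeasurable" and H: "affine H" "aff_dim H = int CARD('m)"
    and sub: "range (\<lambda>s. x0 + A *v s) \<subseteq> H"
  shows "measure (affine_lebesgue TYPE('m) H) ((\<lambda>s. x0 + A *v s) ` S)
    = sqrt (det (transpose A ** A)) * measure lebesgue S"
proof -
  define f where "f = (SOME f :: real^'m \<Rightarrow> real^'n. (\<forall>x y. dist (f x) (f y) = dist x y) \<and> range f = H)"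
  have "\<exists>f :: real^'m \<Rightarrow> real^'n. (\<forall>x y. dist (f x) (f y) = dist x y) \<and> range f = H"
    by (rule isometry_onto_affine[OF H]) blast
  then have "(\<forall>x y. dist (f x) (f y) = dist x y) \<and> range f = H"
    unfolding f_def by (rule someI_ex)
  then have iso: "\<And>x y. dist (f x) (f y) = dist x y" and rng: "range f = H" by auto
  have inj: "inj f" by (rule injI) (metis iso dist_eq_0_iff)
  define h where "h s = inv f (x0 + A *v s)" for s
  have fh: "f (h s) = x0 + A *v s" for s
    unfolding h_def using sub rng by (intro f_inv_into_f) auto
  define k where "k s = h s - h 0" for s
  have k: "k s \<bullet> k t = (A *v s) \<bullet> (A *v t)" for s t
    using isometry_inner_diff[of f "h s" "h 0" "h t"] iso by (simp add: k_def fh)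
  have "linear k"
    by (rule linear_if_inner_eq[OF matrix_vector_mul_linear[of A] k])
  then have kB: "k = (*v) (matrix k)" by simp
  have det: "\<bar>det (matrix k)\<bar> = sqrt (det (transpose A ** A))"
    by (rule det_gram_eq_square) (use k kB in metis)
  have hS: "h ` S = (+) (h 0) ` ((*v) (matrix k) ` S)"
    unfolding kB[symmetric] by (simp add: image_image k_def)
  have meas: "h ` S \<in> lmeasurable"
    unfolding hS by (intro measurable_translation measure_matrix_image S)
  have "(\<lambda>s. x0 + A *v s) ` S = f ` (h ` S)"
    by (simp add: image_image fh)
  then have "measure (affine_lebesgue TYPE('m) H) ((\<lambda>s. x0 + A *v s) ` S)
      = measure (embed_measure lebesgue f) (f ` (h ` S))"
    by (simp add: affine_lebesgue_def f_def)
  also have "\<dots> = measure lebesgue (h ` S)"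
    unfolding measure_def using emeasure_embed_measure_image[OF inj fmeasurableD[OF meas]] by simp
  also have "\<dots> = sqrt (det (transpose A ** A)) * measure lebesgue S"
    unfolding hS by (simp only: measure_translation measure_matrix_image[OF S] det)
  finally show ?thesis .
qed

text \<open>
  Injectivity of \<open>A\<close> gives \<open>range (\<lambda>s. x0 + A *v s)\<close> dimension \<open>CARD('m)\<close>, so an admissible
  subspace \<open>H\<close> exists. Positive measure of \<open>S\<close> forces each admissible \<open>H\<close> to contain that range.
\<close>

lemma Vol_affine_image:
  fixes A :: "real^'m::finite^'n" and x0 :: "real^'n"
  assumes A: "inj ((*v) A)" and S: "S \<in> lmeasurable" "measure lebesgue S > 0"
  shows "Vol TYPE('m) ((\<lambda>s. x0 + A *v s) ` S) = sqrt (det (transpose A ** A)) * measure lebesgue S"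
proof -
  let ?g = "\<lambda>s. x0 + A *v s"
  have img: "?g ` X = (+) x0 ` ((*v) A ` X)" for X by (simp add: image_image)
  have hull: "affine hull (?g ` X) = ?g ` (affine hull X)" for X
    unfolding img affine_hull_translation
    by (simp add: affine_hull_linear_image)
  have "affine hull S = UNIV"
    by (rule affine_hull_UNIV_if_not_negligible) (use S(2) negligible_imp_measure0 in force)
  then have hull_eq: "affine hull (?g ` S) = range ?g"
    by (simp add: hull)
  have dim: "aff_dim (range ?g) = int CARD('m)"
    unfolding img aff_dim_translation_eq using A by simp
  define H where "H = (SOME H. affine H \<and> aff_dim H = int CARD('m) \<and> ?g ` S \<subseteq> H)"
  have "affine H \<and> aff_dim H = int CARD('m) \<and> ?g ` S \<subseteq> H"
    unfolding H_def
    by (rule someI[of _ "range ?g"]) (use dim hull_eq affine_affine_hull[of "?g ` S"] in auto)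
  then have H: "affine H" "aff_dim H = int CARD('m)" and "?g ` S \<subseteq> H" by auto
  then have "range ?g \<subseteq> H"
    unfolding hull_eq[symmetric] by (intro hull_minimal)
  then show ?thesis
    using measure_affine_lebesgue[OF S(1) H] by (simp add: Vol_def H_def)
qed

theorem theorem7p1:
  fixes v :: "'m::finite \<Rightarrow> real^'n"
    and x0 :: "real^'n"
    and A :: "real^'m^'n"
    and P :: "(real^'n) set"
  assumes "CARD('m) \<le> CARD('n)"
    and "inj v" and "independent (range v)"
    and "P = {x0 + (\<Sum>i\<in>UNIV. s $ i *\<^sub>R v i) | s :: real^'m. \<forall>i. 0 \<le> s $ i \<and> s $ i \<le> 1}"
    and "A = (\<chi> i j. v j $ i)"
  shows "Vol TYPE('m) P = sqrt (det (transpose A ** A)) \<and>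
    (\<forall>(\<Sigma>\<^sub>s :: (real^'m) set) (\<Sigma> :: (real^'n) set).
       bounded \<Sigma>\<^sub>s \<longrightarrow> \<Sigma>\<^sub>s \<in> sets lebesgue \<longrightarrow> measure lebesgue \<Sigma>\<^sub>s > 0 \<longrightarrow>
       \<Sigma> = (\<lambda>s. x0 + A *v s) ` \<Sigma>\<^sub>s \<longrightarrow>
       Vol TYPE('m) \<Sigma> / measure lebesgue \<Sigma>\<^sub>s = sqrt (det (transpose A ** A)))"
proof (intro conjI allI impI)
  have Av: "A *v s = (\<Sum>i\<in>UNIV. s $ i *\<^sub>R v i)" for s
    by (simp add: assms(5) matrix_vector_mult_def vec_eq_iff mult.commute)
  have "s = 0" if "A *v s = 0" for s
  proof -
    have "(\<Sum>w\<in>range v. s $ inv v w *\<^sub>R w) = 0"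
      using that by (simp add: Av sum.reindex[OF assms(2)] assms(2))
    then have "\<forall>w\<in>range v. s $ inv v w = 0"
      using assms(3) by (auto simp: independent_explicit dest!: spec[of _ "\<lambda>w. s $ inv v w"])
    then show "s = 0"
      by (simp add: vec_eq_iff assms(2))
  qed
  then have inj: "inj ((*v) A)"
    by (simp add: linear_injective_0)
  let ?Q = "cbox 0 One :: (real^'m) set"
  have "One $ i = (1::real)" for i :: 'm
    by (simp add: cart_eq_inner_axis)
  then have Q: "?Q = {s. \<forall>i. 0 \<le> s $ i \<and> s $ i \<le> 1}"
    by (simp add: set_eq_iff mem_box_cart)
  have "P = (\<lambda>s. x0 + A *v s) ` ?Q"
    by (auto simp: Q assms(4) Av)
  then show "Vol TYPE('m) P = sqrt (det (transpose A ** A))"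
    using Vol_affine_image[OF inj lmeasurable_cbox, of 0 One x0] by simp
  fix \<Sigma>\<^sub>s :: "(real^'m) set" and \<Sigma> :: "(real^'n) set"
  assume "bounded \<Sigma>\<^sub>s" "\<Sigma>\<^sub>s \<in> sets lebesgue" and pos: "measure lebesgue \<Sigma>\<^sub>s > 0"
    and \<Sigma>: "\<Sigma> = (\<lambda>s. x0 + A *v s) ` \<Sigma>\<^sub>s"
  then have "\<Sigma>\<^sub>s \<in> lmeasurable" by (intro bounded_set_imp_lmeasurable)
  then show "Vol TYPE('m) \<Sigma> / measure lebesgue \<Sigma>\<^sub>s = sqrt (det (transpose A ** A))"
    using Vol_affine_image[OF inj _ pos] pos by (simp add: \<Sigma>)
qed

end
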